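(* For $n\ge1$ let $L_n$ be the linear hexagonal chain with vertices $p_0,\dots,p_n,q_0,\dots,q_n,u_0,\dots,u_{n-1},v_0,\dots,v_{n-1}$ and edges $p_iq_i$ $(0\le i\le n)$ and $p_iu_i,\ u_ip_{i+1},\ q_iv_i,\ v_iq_{i+1}$ $(0\le i\le n-1)$; let $r=r_{L_n}$ denote resistance distance in $L_n$, and let $\alpha=3-2\sqrt2$. Then: (i) for all fixed integers $0\le j\le i$, $$\lim_{n\to\infty}r(p_i,p_j)=i-j+\frac{(1-\alpha^{i-j})(2-\alpha^{i+j+1}+\alpha^{2j+1})}{4\sqrt2},\qquad \lim_{n\to\infty}r(q_i,p_j)=i-j+\frac{(1+\alpha^{i-j})(2+\alpha^{i+j+1}+\alpha^{2j+1})}{4\sqrt2};$$ (ii) $\lim_{n\to\infty}\frac1n r(p_n,p_0)=\lim_{n\to\infty}\frac1n r(q_n,p_0)=1$; (iii) $\lim_{n\to\infty}\big[r_{L_{n+1}}(p_{n+1},p_0)-r_{L_n}(p_n,p_0)\big]=\lim_{n\to\infty}\big[r_{L_{n+1}}(q_{n+1},p_0)-r_{L_n}(q_n,p_0)\big]=1$; (iv) $\lim_{n\to\infty}r(p_{\lfloor\frac{n-1}{2}\rfloor+1},p_{\lfloor\frac{n-1}{2}\rfloor})=2-\frac{\sqrt2}{2}$ and $\lim_{n\to\infty}r(p_{\lfloor\frac n2\rfloor},q_{\lfloor\frac n2\rfloor})=\frac{\sqrt2}{2}$.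
   Context: The resistance distance $r(a,b)$ is the effective resistance between $a$ and $b$ when each edge of the graph is a unit resistor. *)

theory Defs
  imports "HOL-Analysis.Analysis"
begin

(* A simple graph is given by a vertex set V and a set E of two-element subsets of V. *)

definition neighbours :: "'a set \<Rightarrow> 'a set set \<Rightarrow> 'a \<Rightarrow> 'a set" where
  "neighbours V E x = {y \<in> V. {x, y} \<in> E}"

(* With unit resistors, Ohm's law says that the current from x to an adjacent y is
   phi x - phi y.  Kirchhoff's current law says that the net current leaving x is 1 at the
   source a, -1 at the sink b and 0 elsewhere (and 0 everywhere if a = b). *)
definition unit_current_potential ::
    "'a set \<Rightarrow> 'a set set \<Rightarrow> 'a \<Rightarrow> 'a \<Rightarrow> ('a \<Rightarrow> real) \<Rightarrow> bool" where
  "unit_current_potential V E a b \<phi> \<longleftrightarrow>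
     (\<forall>x\<in>V. (\<Sum>y\<in>neighbours V E x. \<phi> x - \<phi> y) = of_bool (x = a) - of_bool (x = b))"

(* The effective resistance is the voltage between a and b when a unit current flows from
   a to b.  For a, b in V and (V, E) finite and connected, such a potential exists and is
   unique on V up to an additive constant, so the voltage is uniquely determined. *)
definition resistance_distance :: "'a set \<Rightarrow> 'a set set \<Rightarrow> 'a \<Rightarrow> 'a \<Rightarrow> real" where
  "resistance_distance V E a b =
     (THE r. \<exists>\<phi>. unit_current_potential V E a b \<phi> \<and> r = \<phi> a - \<phi> b)"

datatype hex_vertex = P nat | Q nat | U nat | V nat

definition hex_chain_verts :: "nat \<Rightarrow> hex_vertex set" where
  "hex_chain_verts n = P ` {..n} \<union> Q ` {..n} \<union> U ` {..<n} \<union> V ` {..<n}"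

definition hex_chain_edges :: "nat \<Rightarrow> hex_vertex set set" where
  "hex_chain_edges n =
     (\<lambda>i. {P i, Q i}) ` {..n} \<union>
     (\<lambda>i. {P i, U i}) ` {..<n} \<union> (\<lambda>i. {U i, P (Suc i)}) ` {..<n} \<union>
     (\<lambda>i. {Q i, V i}) ` {..<n} \<union> (\<lambda>i. {V i, Q (Suc i)}) ` {..<n}"

definition hex_resistance :: "nat \<Rightarrow> hex_vertex \<Rightarrow> hex_vertex \<Rightarrow> real" where
  "hex_resistance n = resistance_distance (hex_chain_verts n) (hex_chain_edges n)"

end

theory Submission
  imports Defs "HOL-Real_Asymp.Real_Asymp"
begin

text \<open>
  Eliminating the degree-two vertices \<open>u\<^sub>k, v\<^sub>k\<close> leaves a ladder with rail conductances
  \<open>1/2\<close>. The sum \<open>s\<close> and the difference \<open>d\<close> of the potentials on the two rails decouple: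
  \<open>s\<close> solves a Neumann problem for the second difference on a path, solved by \<open>2 min(i,k)\<close>,
  and \<open>d\<close> solves \<open>6 d\<^sub>k - d\<^bsub>k-1\<^esub> - d\<^bsub>k+1\<^esub> = f\<^sub>k\<close>, whose Green function \<open>G\<close> is a product of two
  solutions of the homogeneous recurrence, with characteristic roots \<open>\<alpha>\<close> and \<open>1/\<alpha>\<close>. This gives
  \<open>r(p\<^sub>i,p\<^sub>j) = \<bar>i-j\<bar> + (G\<^sub>i\<^sub>i + G\<^sub>j\<^sub>j - 2 G\<^sub>i\<^sub>j)/2\<close> and
  \<open>r(q\<^sub>i,p\<^sub>j) = \<bar>i-j\<bar> + (G\<^sub>i\<^sub>i + G\<^sub>j\<^sub>j + 2 G\<^sub>i\<^sub>j)/2\<close>, and the limits are read off the closed form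
  of \<open>G\<close>.
\<close>

section \<open>Reciprocity and effective resistance\<close>

text \<open>Since \<open>{x, y}\<close> is unordered, adjacency is symmetric: the diagonal part of
  the expanded form is symmetric in the two functions, and the off-diagonal part becomes so after
  exchanging the summations.\<close>

lemma laplacian_self_adjoint:
  fixes \<phi> \<psi> :: "'a \<Rightarrow> real"
  assumes "finite S"
  shows "(\<Sum>x\<in>S. \<psi> x * (\<Sum>y\<in>neighbours S E x. \<phi> x - \<phi> y)) =
         (\<Sum>x\<in>S. \<phi> x * (\<Sum>y\<in>neighbours S E x. \<psi> x - \<psi> y))"
proof -
  have expand: "(\<Sum>x\<in>S. g x * (\<Sum>y\<in>neighbours S E x. f x - f y)) =
      (\<Sum>x\<in>S. \<Sum>y\<in>S. of_bool ({x, y} \<in> E) * (f x * g x)) -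
      (\<Sum>x\<in>S. \<Sum>y\<in>S. of_bool ({x, y} \<in> E) * (g x * f y))" for f g :: "'a \<Rightarrow> real"
  proof -
    have "g x * (\<Sum>y\<in>neighbours S E x. f x - f y) =
        (\<Sum>y\<in>S. of_bool ({x, y} \<in> E) * (f x * g x)) -
        (\<Sum>y\<in>S. of_bool ({x, y} \<in> E) * (g x * f y))" for x
    proof -
      have "(\<Sum>y\<in>neighbours S E x. f x - f y) = (\<Sum>y\<in>S. of_bool ({x, y} \<in> E) * (f x - f y))"
        unfolding neighbours_def by (rule sum.mono_neutral_cong_left) (use assms in auto)
      then show ?thesis
        by (simp add: sum_distrib_left algebra_simps flip: sum_subtractf)
    qed
    then show ?thesis by (simp add: sum_subtractf)
  qed
  have "(\<Sum>x\<in>S. \<Sum>y\<in>S. of_bool ({x, y} \<in> E) * (\<psi> x * \<phi> y)) =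
      (\<Sum>x\<in>S. \<Sum>y\<in>S. of_bool ({x, y} \<in> E) * (\<phi> x * \<psi> y))"
    by (subst sum.swap) (simp add: insert_commute mult.commute)
  then show ?thesis by (simp add: expand mult.commute)
qed

text \<open>Pairing with the Laplacian of a unit-current potential reads off a voltage; with
  self-adjointness, any two unit-current potentials then give the same voltage.\<close>

lemma sum_mult_unit_current:
  fixes \<psi> :: "'a \<Rightarrow> real"
  assumes "finite S" "a \<in> S" "b \<in> S" "unit_current_potential S E a b \<phi>"
  shows "(\<Sum>x\<in>S. \<psi> x * (\<Sum>y\<in>neighbours S E x. \<phi> x - \<phi> y)) = \<psi> a - \<psi> b"
proof -
  have "(\<Sum>x\<in>S. \<psi> x * (\<Sum>y\<in>neighbours S E x. \<phi> x - \<phi> y)) =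
      (\<Sum>x\<in>S. \<psi> x * of_bool (x = a)) - (\<Sum>x\<in>S. \<psi> x * of_bool (x = b))"
    using assms(4) by (simp add: unit_current_potential_def right_diff_distrib sum_subtractf)
  also have "\<dots> = \<psi> a - \<psi> b"
    using assms(1-3) by (simp add: of_bool_def if_distrib cong: if_cong)
  finally show ?thesis .
qed

text \<open>Uniqueness of the voltage is reciprocity, so connectedness of the graph plays no role.\<close>

lemma resistance_distance_eq:
  assumes "finite S" "a \<in> S" "b \<in> S" "unit_current_potential S E a b \<phi>"
  shows "resistance_distance S E a b = \<phi> a - \<phi> b"
  unfolding resistance_distance_def
proof (rule the_equality)
  show "\<exists>\<psi>. unit_current_potential S E a b \<psi> \<and> \<phi> a - \<phi> b = \<psi> a - \<psi> b"
    using assms(4) by blast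
next
  fix r assume "\<exists>\<psi>. unit_current_potential S E a b \<psi> \<and> r = \<psi> a - \<psi> b"
  then obtain \<psi> where \<psi>: "unit_current_potential S E a b \<psi>" and r: "r = \<psi> a - \<psi> b" by blast
  have "\<psi> a - \<psi> b = \<phi> a - \<phi> b"
    unfolding sum_mult_unit_current[OF assms, of \<psi>, symmetric]
      sum_mult_unit_current[OF assms(1-3) \<psi>, of \<phi>, symmetric]
    by (rule laplacian_self_adjoint[OF assms(1)])
  with r show "r = \<phi> a - \<phi> b" by simp
qed

section \<open>Adjacency in the hexagonal chain\<close>

lemma finite_hex_chain_verts: "finite (hex_chain_verts n)"
  by (simp add: hex_chain_verts_def)

lemma neighbours_hex_P:
  assumes "k \<le> n"
  shows "neighbours (hex_chain_verts n) (hex_chain_edges n) (P k) =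
    insert (Q k) ((if k < n then {U k} else {}) \<union> (if 0 < k then {U (k - 1)} else {}))"
proof (rule set_eqI)
  fix y
  show "y \<in> neighbours (hex_chain_verts n) (hex_chain_edges n) (P k) \<longleftrightarrow> y \<in> insert (Q k)
      ((if k < n then {U k} else {}) \<union> (if 0 < k then {U (k - 1)} else {}))"
    using assms
    by (cases y; cases k)
      (auto simp: neighbours_def hex_chain_verts_def hex_chain_edges_def doubleton_eq_iff image_iff)
qed

lemma neighbours_hex_Q:
  assumes "k \<le> n"
  shows "neighbours (hex_chain_verts n) (hex_chain_edges n) (Q k) =
    insert (P k) ((if k < n then {V k} else {}) \<union> (if 0 < k then {V (k - 1)} else {}))"
proof (rule set_eqI)
  fix y
  show "y \<in> neighbours (hex_chain_verts n) (hex_chain_edges n) (Q k) \<longleftrightarrow> y \<in> insert (P k)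
      ((if k < n then {V k} else {}) \<union> (if 0 < k then {V (k - 1)} else {}))"
    using assms
    by (cases y; cases k)
      (auto simp: neighbours_def hex_chain_verts_def hex_chain_edges_def doubleton_eq_iff image_iff)
qed

lemma neighbours_hex_U:
  assumes "k < n"
  shows "neighbours (hex_chain_verts n) (hex_chain_edges n) (U k) = {P k, P (Suc k)}"
proof (rule set_eqI)
  fix y
  show "y \<in> neighbours (hex_chain_verts n) (hex_chain_edges n) (U k) \<longleftrightarrow> y \<in> {P k, P (Suc k)}"
    using assms
    by (cases y)
      (auto simp: neighbours_def hex_chain_verts_def hex_chain_edges_def doubleton_eq_iff image_iff)
qed

lemma neighbours_hex_V:
  assumes "k < n"
  shows "neighbours (hex_chain_verts n) (hex_chain_edges n) (V k) = {Q k, Q (Suc k)}"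
proof (rule set_eqI)
  fix y
  show "y \<in> neighbours (hex_chain_verts n) (hex_chain_edges n) (V k) \<longleftrightarrow> y \<in> {Q k, Q (Suc k)}"
    using assms
    by (cases y)
      (auto simp: neighbours_def hex_chain_verts_def hex_chain_edges_def doubleton_eq_iff image_iff)
qed

section \<open>Decoupling the two rails\<close>

text \<open>Degree-two vertices receive the mean of their two neighbours, so no net current leaves
  them.\<close>

fun rail_potential :: "(nat \<Rightarrow> real) \<Rightarrow> (nat \<Rightarrow> real) \<Rightarrow> hex_vertex \<Rightarrow> real" where
  "rail_potential s d (P k) = (s k + d k) / 2"
| "rail_potential s d (Q k) = (s k - d k) / 2"
| "rail_potential s d (U k) = (s k + d k + s (Suc k) + d (Suc k)) / 4"
| "rail_potential s d (V k) = (s k - d k + s (Suc k) - d (Suc k)) / 4"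

text \<open>
  Truncated \<open>k - 1\<close> and \<open>min (Suc k) n\<close> encode the free (Neumann) ends of the chain: a missing
  neighbour of an end vertex is replaced by the vertex itself.
\<close>

lemma unit_current_rail_potential:
  assumes s: "\<And>k. k \<le> n \<Longrightarrow> 2 * s k - s (k - 1) - s (min (Suc k) n) =
      2 * (of_bool (P k = a) + of_bool (Q k = a) - of_bool (P k = b) - of_bool (Q k = b))"
    and d: "\<And>k. k \<le> n \<Longrightarrow> 6 * d k - d (k - 1) - d (min (Suc k) n) =
      2 * (of_bool (P k = a) - of_bool (Q k = a) - of_bool (P k = b) + of_bool (Q k = b))"
    and ab: "a \<in> range P \<union> range Q" "b \<in> range P \<union> range Q"
  shows "unit_current_potential (hex_chain_verts n) (hex_chain_edges n) a b (rail_potential s d)"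
  unfolding unit_current_potential_def
proof
  fix x assume "x \<in> hex_chain_verts n"
  then consider k where "x = P k" "k \<le> n" | k where "x = Q k" "k \<le> n"
    | k where "x = U k" "k < n" | k where "x = V k" "k < n"
    by (auto simp: hex_chain_verts_def)
  then show "(\<Sum>y\<in>neighbours (hex_chain_verts n) (hex_chain_edges n) x.
      rail_potential s d x - rail_potential s d y) = of_bool (x = a) - of_bool (x = b)"
  proof cases
    case 1
    then show ?thesis
      using s[OF 1(2)] d[OF 1(2)]
      \<comment> \<open>Kirchhoff's law at \<open>P k\<close> is a quarter of the sum of the two
        recurrences; at \<open>Q k\<close> it is a quarter of their difference.\<close>
      by (cases k; cases "k = n") (simp_all add: neighbours_hex_P min_def field_simps)
  next
    case 2
    then show ?thesis
      using s[OF 2(2)] d[OF 2(2)]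
      by (cases k; cases "k = n") (simp_all add: neighbours_hex_Q min_def field_simps)
  next
    case 3
    then have "x \<noteq> a" "x \<noteq> b" using ab by auto
    with 3 show ?thesis by (simp add: neighbours_hex_U field_simps)
  next
    case 4
    then have "x \<noteq> a" "x \<noteq> b" using ab by auto
    with 4 show ?thesis by (simp add: neighbours_hex_V field_simps)
  qed
qed

section \<open>Green function of the difference equation\<close>

text \<open>
  The solution of \<open>h\<^bsub>k+1\<^esub> = 6 h\<^sub>k - h\<^bsub>k-1\<^esub>\<close> satisfying the free boundary condition
  \<open>h\<^bsub>-1\<^esub> = h\<^sub>0\<close> at the left end.
\<close>

fun hom_sol :: "nat \<Rightarrow> real" where
  "hom_sol 0 = 1"
| "hom_sol (Suc k) = 6 * hom_sol k - hom_sol (k - 1)"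

text \<open>By the recurrence, moving one unit from \<open>b\<close> to \<open>a\<close> leaves the
  left side unchanged, so it depends only on \<open>a + b\<close> and can be evaluated at
  \<open>b = 0\<close>.\<close>

lemma hom_sol_wronskian:
  "hom_sol (Suc a) * hom_sol b - hom_sol a * hom_sol (b - 1) =
   hom_sol (Suc (a + b)) - hom_sol (a + b)"
proof (induction b arbitrary: a)
  case 0
  then show ?case by simp
next
  case (Suc b)
  from Suc[of "Suc a"] show ?case by (simp add: algebra_simps)
qed

text \<open>Positivity and growth support each other in the induction; growth makes the denominator
  of \<open>green\<close> nonzero.\<close>

lemma hom_sol_mono: "1 \<le> hom_sol k \<and> hom_sol k < hom_sol (Suc k)"
proof (induction k)
  case (Suc k)
  then show ?case by simp
qed simp

text \<open>The first factor meets the free condition at 0, its mirror image the one at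
  \<open>n\<close>, and the denominator is their Wronskian. The 2 comes from clearing the rail
  conductance 1/2.\<close>

definition green :: "nat \<Rightarrow> nat \<Rightarrow> nat \<Rightarrow> real" where
  "green n i k =
     2 * hom_sol (min i k) * hom_sol (n - max i k) / (hom_sol (Suc n) - hom_sol n)"

lemma green_commute: "green n i k = green n k i"
  by (simp add: green_def min.commute max.commute)

text \<open>Off the diagonal one factor is constant in \<open>k\<close> and the other solves the
  homogeneous recurrence; on the diagonal the defect is the Wronskian.\<close>

lemma green_equation:
  assumes "i \<le> n" "k \<le> n"
  shows "6 * green n i k - green n i (k - 1) - green n i (min (Suc k) n) = 2 * of_bool (k = i)"
proof -
  define W where "W = hom_sol (Suc n) - hom_sol n"
  have W: "W \<noteq> 0" using hom_sol_mono[of n] by (simp add: W_def)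
  define u where
    "u m = hom_sol (min i m) * hom_sol (n - max i m)" for m
  have green: "green n i m = 2 * u m / W" for m
    by (simp add: green_def u_def W_def)
  have "6 * u k - u (k - 1) - u (min (Suc k) n) = of_bool (k = i) * W"
  proof (cases k i rule: linorder_cases)
    case less
    then have "min i k = k" "min i (k - 1) = k - 1" "min i (min (Suc k) n) = Suc k"
      "max i k = i" "max i (k - 1) = i" "max i (min (Suc k) n) = i"
      using assms by auto
    then show ?thesis using less by (simp add: u_def algebra_simps)
  next
    case greater
    \<comment> \<open>At \<open>k = n\<close> both \<open>n - k\<close> and \<open>n - k - 1\<close>
      are 0, which matches the truncation in \<open>hom_sol\<close> and encodes the free right
      end.\<close>
    then have "min i k = i" "min i (k - 1) = i" "min i (min (Suc k) n) = i"
      "n - max i (k - 1) = Suc (n - k)" "max i k = k"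
      "n - max i (min (Suc k) n) = n - k - 1"
      using assms by auto
    then show ?thesis using greater by (simp add: u_def algebra_simps)
  next
    case equal
    then have "min i k = k" "min i (k - 1) = k - 1" "min i (min (Suc k) n) = k"
      "max i k = k" "max i (k - 1) = k" "n - max i (min (Suc k) n) = n - k - 1"
      using assms by auto
    then show ?thesis
      using equal assms hom_sol_wronskian[of k "n - k"]
      by (simp add: u_def W_def algebra_simps)
  qed
  then have "(6 * u k - u (k - 1) - u (min (Suc k) n)) / W = of_bool (k = i)"
    using W by (cases "k = i") auto
  then show ?thesis
    by (simp add: green diff_divide_distrib)
qed

section \<open>Path potentials and exact resistances for finite chains\<close>

text \<open>With both ends free the sources must sum to zero, so the source at \<open>i\<close> is
  balanced by a sink at 0, which cancels in the difference of two such potentials.\<close>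

definition path_potential :: "nat \<Rightarrow> nat \<Rightarrow> real" where
  "path_potential i k = 2 * real (min i k)"

lemma path_potential_equation:
  assumes "i \<le> n" "k \<le> n"
  shows "2 * path_potential i k - path_potential i (k - 1) - path_potential i (min (Suc k) n) =
    2 * (of_bool (k = i) - of_bool (k = 0))"
  using assms
  by (cases k; cases k i rule: linorder_cases) (auto simp: path_potential_def min_def)

lemma hex_resistance_PP:
  assumes "j \<le> i" "i \<le> n"
  shows "hex_resistance n (P i) (P j) =
    real i - real j + (green n i i + green n j j - 2 * green n i j) / 2"
proof -
  define s where "s k = path_potential i k - path_potential j k" for k
  define d where "d k = green n i k - green n j k" for k
  have "unit_current_potential (hex_chain_verts n) (hex_chain_edges n) (P i) (P j)
      (rail_potential s d)"
  proof (rule unit_current_rail_potential)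
    fix k assume k: "k \<le> n"
    show "2 * s k - s (k - 1) - s (min (Suc k) n) = 2 * (of_bool (P k = P i) +
        of_bool (Q k = P i) - of_bool (P k = P j) - of_bool (Q k = P j))"
      using path_potential_equation[OF assms(2) k] path_potential_equation[OF le_trans[OF assms] k]
      by (simp only: s_def hex_vertex.inject hex_vertex.distinct of_bool_eq) algebra
    show "6 * d k - d (k - 1) - d (min (Suc k) n) = 2 * (of_bool (P k = P i) -
        of_bool (Q k = P i) - of_bool (P k = P j) + of_bool (Q k = P j))"
      using green_equation[OF assms(2) k] green_equation[OF le_trans[OF assms] k]
      by (simp add: d_def algebra_simps)
  qed auto
  then have "hex_resistance n (P i) (P j) = rail_potential s d (P i) - rail_potential s d (P j)"
    unfolding hex_resistance_def using assms
    by (intro resistance_distance_eq finite_hex_chain_verts) (auto simp: hex_chain_verts_def)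
  then show ?thesis
    using assms by (simp add: s_def d_def path_potential_def green_commute[of n j i] field_simps)
qed

lemma hex_resistance_QP:
  assumes "j \<le> i" "i \<le> n"
  shows "hex_resistance n (Q i) (P j) =
    real i - real j + (green n i i + green n j j + 2 * green n i j) / 2"
proof -
  define s where "s k = path_potential i k - path_potential j k" for k
  \<comment> \<open>A source on the \<open>Q\<close> rail enters the difference equation with the
    opposite sign, hence the first minus.\<close>
  define d where "d k = - green n i k - green n j k" for k
  have "unit_current_potential (hex_chain_verts n) (hex_chain_edges n) (Q i) (P j)
      (rail_potential s d)"
  proof (rule unit_current_rail_potential)
    fix k assume k: "k \<le> n"
    show "2 * s k - s (k - 1) - s (min (Suc k) n) = 2 * (of_bool (P k = Q i) +
        of_bool (Q k = Q i) - of_bool (P k = P j) - of_bool (Q k = P j))"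
      using path_potential_equation[OF assms(2) k] path_potential_equation[OF le_trans[OF assms] k]
      by (simp only: s_def hex_vertex.inject hex_vertex.distinct of_bool_eq) algebra
    show "6 * d k - d (k - 1) - d (min (Suc k) n) = 2 * (of_bool (P k = Q i) -
        of_bool (Q k = Q i) - of_bool (P k = P j) + of_bool (Q k = P j))"
      using green_equation[OF assms(2) k] green_equation[OF le_trans[OF assms] k]
      by (simp add: d_def algebra_simps)
  qed auto
  then have "hex_resistance n (Q i) (P j) = rail_potential s d (Q i) - rail_potential s d (P j)"
    unfolding hex_resistance_def using assms
    by (intro resistance_distance_eq finite_hex_chain_verts) (auto simp: hex_chain_verts_def)
  then show ?thesis
    using assms by (simp add: s_def d_def path_potential_def green_commute[of n j i] field_simps)
qed

text \<open>Negating a potential reverses the current, so both definite descriptions have the same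
  predicate.\<close>

lemma resistance_distance_commute:
  "resistance_distance S E a b = resistance_distance S E b a"
proof -
  have neg: "unit_current_potential S E b a (\<lambda>x. - \<phi> x)"
    if "unit_current_potential S E a b \<phi>" for a b and \<phi> :: "'a \<Rightarrow> real"
  proof -
    have "(\<Sum>y\<in>N. - \<phi> x - - \<phi> y) = - (\<Sum>y\<in>N. \<phi> x - \<phi> y)" for x N
      by (simp flip: sum_negf)
    with that show ?thesis by (simp add: unit_current_potential_def)
  qed
  have "(\<exists>\<phi>. unit_current_potential S E b a \<phi> \<and> r = \<phi> b - \<phi> a)"
    if "\<exists>\<phi>. unit_current_potential S E a b \<phi> \<and> r = \<phi> a - \<phi> b" for r a b
    using that neg by fastforce
  then have "(\<exists>\<phi>. unit_current_potential S E a b \<phi> \<and> r = \<phi> a - \<phi> b) \<longleftrightarrow>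
      (\<exists>\<phi>. unit_current_potential S E b a \<phi> \<and> r = \<phi> b - \<phi> a)" for r
    by blast
  then show ?thesis by (simp add: resistance_distance_def)
qed

section \<open>Closed form of the Green function in powers of \<open>\<alpha>\<close>\<close>

context
  fixes \<alpha> :: real
  assumes \<alpha>: "\<alpha> = 3 - 2 * sqrt 2"
begin

lemma alpha_pos: "0 < \<alpha>"
proof -
  have "sqrt 2 < 3 / 2" by (rule real_less_lsqrt) (auto simp: power2_eq_square)
  then show ?thesis by (simp add: \<alpha>)
qed

lemma alpha_less_1: "\<alpha> < 1"
  using real_sqrt_less_iff[of 1 2] by (simp add: \<alpha>)

text \<open>This is the characteristic equation of the \<open>hom_sol\<close> recurrence.\<close>

lemma alpha_square: "\<alpha> * \<alpha> = 6 * \<alpha> - 1"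
  by (simp add: \<alpha> algebra_simps)

lemma one_minus_alpha_square: "1 - \<alpha> * \<alpha> = 4 * sqrt 2 * \<alpha>"
  by (simp add: \<alpha> algebra_simps)

lemma alpha_power_tendsto_0:
  assumes "filterlim f at_top F"
  shows "((\<lambda>n. \<alpha> ^ f n) \<longlongrightarrow> 0) F"
  using filterlim_compose[OF LIMSEQ_realpow_zero assms] alpha_pos alpha_less_1 by simp

text \<open>The combination of the characteristic solutions that fits the free left end, with
  negative powers cleared.\<close>

lemma hom_sol_closed: "\<alpha> ^ k * hom_sol k * (1 + \<alpha>) = 1 + \<alpha> ^ (2 * k + 1)"
proof (induction k rule: less_induct)
  case (less k)
  consider "k = 0" | "k = 1" | m where "k = Suc (Suc m)"
    by (metis One_nat_def not0_implies_Suc)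
  then show ?case
  proof cases
    case 2
    \<comment> \<open>The 5 is \<open>hom_sol 1\<close>. This case is separate because the truncated
      index breaks the two-step recurrence here.\<close>
    have "\<alpha> * 5 * (1 + \<alpha>) = 1 + \<alpha> ^ 3" using alpha_square by algebra
    then show ?thesis by (simp add: 2 power3_eq_cube)
  next
    case 3
    define x where "x = \<alpha> ^ m"
    have pow: "\<alpha> ^ (2 * m) = x * x" by (simp add: x_def mult_2 power_add)
    have "x * hom_sol m * (1 + \<alpha>) = 1 + \<alpha> * (x * x)"
      "\<alpha> * x * hom_sol (Suc m) * (1 + \<alpha>) = 1 + \<alpha> * (\<alpha> * (\<alpha> * (x * x)))"
      using less[of m] less[of "Suc m"] 3 by (simp_all add: pow flip: x_def)
    then have "\<alpha> * (\<alpha> * x) * (6 * hom_sol (Suc m) - hom_sol m) * (1 + \<alpha>) =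
        1 + \<alpha> * (\<alpha> * (\<alpha> * (\<alpha> * (\<alpha> * (x * x)))))"
      using alpha_square by algebra
    then show ?thesis by (simp add: 3 pow flip: x_def)
  qed simp
qed

lemma green_closed:
  assumes "j \<le> i" "i \<le> n"
  shows "green n i j = \<alpha> ^ (i - j) * (1 + \<alpha> ^ (2 * j + 1)) * (1 + \<alpha> ^ (2 * (n - i) + 1)) /
    (2 * sqrt 2 * (1 - \<alpha> ^ (2 * n + 2)))"
proof -
  define W where "W = hom_sol (Suc n) - hom_sol n"
  have "W > 0" using hom_sol_mono[of n] by (simp add: W_def)
  have "\<alpha> ^ Suc n * W * (1 + \<alpha>) = (1 - \<alpha>) * (1 - \<alpha> ^ (2 * n + 2))"
    using hom_sol_closed[of n] hom_sol_closed[of "Suc n"]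
    by (simp add: W_def algebra_simps del: hom_sol.simps)
  \<comment> \<open>A second factor \<open>1 + \<alpha>\<close> turns \<open>1 - \<alpha>\<close>
    into \<open>1 - \<alpha> * \<alpha>\<close>, the origin of \<open>sqrt 2\<close> in the
    limits.\<close>
  then have "\<alpha> ^ Suc n * W * (1 + \<alpha>)\<^sup>2 = 4 * sqrt 2 * \<alpha> * (1 - \<alpha> ^ (2 * n + 2))"
    by (simp add: power2_eq_square flip: mult.assoc one_minus_alpha_square)
      (simp add: algebra_simps)
  then have den: "\<alpha> ^ n * W * (1 + \<alpha>)\<^sup>2 = 4 * sqrt 2 * (1 - \<alpha> ^ (2 * n + 2))"
    using alpha_pos by simp
  \<comment> \<open>Splitting the exponent gives each \<open>hom_sol\<close> factor the power its
    closed form requires and leaves the decay over the distance \<open>i - j\<close>.\<close>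
  have "\<alpha> ^ n = \<alpha> ^ (i - j) * \<alpha> ^ j * \<alpha> ^ (n - i)"
    using assms by (simp flip: power_add)
  then have num: "\<alpha> ^ n * (hom_sol j * hom_sol (n - i)) * (1 + \<alpha>)\<^sup>2 =
      \<alpha> ^ (i - j) * (1 + \<alpha> ^ (2 * j + 1)) * (1 + \<alpha> ^ (2 * (n - i) + 1))"
    unfolding hom_sol_closed[symmetric] by (simp add: power2_eq_square)
  have nz: "\<alpha> \<noteq> 0" "1 + \<alpha> \<noteq> 0" using alpha_pos by auto
  have "green n i j = 2 * (\<alpha> ^ n * (hom_sol j * hom_sol (n - i)) * (1 + \<alpha>)\<^sup>2) /
      (\<alpha> ^ n * W * (1 + \<alpha>)\<^sup>2)"
    using assms nz by (simp add: green_def W_def min_def max_def del: hom_sol.simps)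
  also have "\<dots> = 2 * (\<alpha> ^ (i - j) * (1 + \<alpha> ^ (2 * j + 1)) * (1 + \<alpha> ^ (2 * (n - i) + 1))) /
      (4 * sqrt 2 * (1 - \<alpha> ^ (2 * n + 2)))"
    unfolding num den ..
  finally show ?thesis by simp
qed

section \<open>Limits of the Green function near the ends and in the bulk\<close>

lemma green_tendsto:
  assumes le: "\<forall>\<^sub>F n in sequentially. j n \<le> i n \<and> i n \<le> n"
    and A: "(\<lambda>n. \<alpha> ^ (i n - j n)) \<longlonglongrightarrow> A"
    and B: "(\<lambda>n. \<alpha> ^ (2 * j n + 1)) \<longlonglongrightarrow> B"
    and C: "(\<lambda>n. \<alpha> ^ (2 * (n - i n) + 1)) \<longlonglongrightarrow> C"
  shows "(\<lambda>n. green n (i n) (j n)) \<longlonglongrightarrow> A * (1 + B) * (1 + C) / (2 * sqrt 2)"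
proof -
  have "filterlim (\<lambda>n::nat. 2 * n + 2) at_top sequentially" by real_asymp
  note D = alpha_power_tendsto_0[OF this]
  have "(\<lambda>n. \<alpha> ^ (i n - j n) * (1 + \<alpha> ^ (2 * j n + 1)) * (1 + \<alpha> ^ (2 * (n - i n) + 1)) /
      (2 * sqrt 2 * (1 - \<alpha> ^ (2 * n + 2)))) \<longlonglongrightarrow>
      A * (1 + B) * (1 + C) / (2 * sqrt 2 * (1 - 0))"
    by (intro tendsto_intros A B C D) auto
  then show ?thesis
    using filterlim_cong[OF refl refl eventually_mono[OF le green_closed]] by simp
qed

lemma green_fixed_tendsto:
  assumes "j \<le> i"
  shows "(\<lambda>n. green n i j) \<longlonglongrightarrow> (\<alpha> ^ (i - j) + \<alpha> ^ (i + j + 1)) / (2 * sqrt 2)"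
proof -
  have "filterlim (\<lambda>n::nat. 2 * (n - i) + 1) at_top sequentially" by real_asymp
  note C = alpha_power_tendsto_0[OF this]
  have "(\<lambda>n. green n i j) \<longlonglongrightarrow> \<alpha> ^ (i - j) * (1 + \<alpha> ^ (2 * j + 1)) * (1 + 0) / (2 * sqrt 2)"
    using assms eventually_ge_at_top[of i] by (intro green_tendsto C tendsto_const) simp
  moreover have "\<alpha> ^ (i - j) * \<alpha> ^ (2 * j + 1) = \<alpha> ^ (i + j + 1)"
    using assms by (simp add: add.commute flip: power_add)
  ultimately show ?thesis by (simp only: distrib_left mult_1_right add_0_right)
qed

text \<open>At the right end the factor \<open>1 + \<alpha>\<close> of that boundary persists;
  between opposite ends the power of the distance vanishes.\<close>

lemma green_corner_tendsto:
  "(\<lambda>n. green n n n) \<longlonglongrightarrow> (1 + \<alpha>) / (2 * sqrt 2)" "(\<lambda>n. green n n 0) \<longlonglongrightarrow> 0"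
proof -
  have "filterlim (\<lambda>n::nat. 2 * n + 1) at_top sequentially" by real_asymp
  note B = alpha_power_tendsto_0[OF this]
  have "(\<lambda>n. green n n n) \<longlonglongrightarrow> 1 * (1 + 0) * (1 + \<alpha>) / (2 * sqrt 2)"
    by (intro green_tendsto B) auto
  then show "(\<lambda>n. green n n n) \<longlonglongrightarrow> (1 + \<alpha>) / (2 * sqrt 2)" by simp
  have "filterlim (\<lambda>n::nat. n - 0) at_top sequentially" by real_asymp
  note A = alpha_power_tendsto_0[OF this]
  have "(\<lambda>n. green n n 0) \<longlonglongrightarrow> 0 * (1 + \<alpha>) * (1 + \<alpha>) / (2 * sqrt 2)"
    by (intro green_tendsto A) auto
  then show "(\<lambda>n. green n n 0) \<longlonglongrightarrow> 0" by simp
qed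

text \<open>Far from both ends the boundary factors tend to 1, leaving the Green function of the
  doubly infinite ladder.\<close>

lemma green_bulk_tendsto:
  assumes "\<forall>\<^sub>F n in sequentially. j n \<le> i n \<and> i n \<le> n \<and> i n - j n = m"
    and "filterlim j at_top sequentially" "filterlim (\<lambda>n. n - i n) at_top sequentially"
  shows "(\<lambda>n. green n (i n) (j n)) \<longlonglongrightarrow> \<alpha> ^ m / (2 * sqrt 2)"
proof -
  have "filterlim (\<lambda>k::nat. 2 * k + 1) at_top sequentially" by real_asymp
  note lim = alpha_power_tendsto_0[OF filterlim_compose[OF this]]
  have "(\<lambda>n. \<alpha> ^ (i n - j n)) \<longlonglongrightarrow> \<alpha> ^ m"
    by (rule tendsto_eventually) (use assms(1) in \<open>auto elim: eventually_mono\<close>)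
  then have "(\<lambda>n. green n (i n) (j n)) \<longlonglongrightarrow> \<alpha> ^ m * (1 + 0) * (1 + 0) / (2 * sqrt 2)"
    by (intro green_tendsto lim assms) (use assms(1) in \<open>auto elim: eventually_mono\<close>)
  then show ?thesis by simp
qed

section \<open>Limits of the resistances\<close>

lemma hex_resistance_PP_limit:
  assumes "j \<le> i"
  shows "(\<lambda>n. hex_resistance n (P i) (P j)) \<longlonglongrightarrow> real i - real j
    + (1 - \<alpha> ^ (i - j)) * (2 - \<alpha> ^ (i + j + 1) + \<alpha> ^ (2 * j + 1)) / (4 * sqrt 2)"
proof -
  \<comment> \<open>In these variables the required factorisation is a polynomial identity.\<close>
  define x y where "x = \<alpha> ^ (i - j)" and "y = \<alpha> ^ j"
  have "\<alpha> ^ i = x * y" using assms by (simp add: x_def y_def flip: power_add)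
  then have pows: "\<alpha> ^ (i - i) = 1" "\<alpha> ^ (j - j) = 1" "\<alpha> ^ (i - j) = x"
    "\<alpha> ^ (i + i + 1) = \<alpha> * (x * y) * (x * y)" "\<alpha> ^ (j + j + 1) = \<alpha> * y * y"
    "\<alpha> ^ (i + j + 1) = \<alpha> * (x * y) * y" "\<alpha> ^ (2 * j + 1) = \<alpha> * y * y"
    by (simp_all add: x_def y_def power_add mult_2)
  have "(\<lambda>n. real i - real j + (green n i i + green n j j - 2 * green n i j) / 2) \<longlonglongrightarrow>
      real i - real j + ((\<alpha> ^ (i - i) + \<alpha> ^ (i + i + 1)) / (2 * sqrt 2)
        + (\<alpha> ^ (j - j) + \<alpha> ^ (j + j + 1)) / (2 * sqrt 2)
        - 2 * ((\<alpha> ^ (i - j) + \<alpha> ^ (i + j + 1)) / (2 * sqrt 2))) / 2"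
    (is "_ \<longlonglongrightarrow> ?l")
    by (intro tendsto_intros green_fixed_tendsto assms order_refl) auto
  also have "?l = real i - real j + (\<alpha> ^ (i - i) + \<alpha> ^ (i + i + 1) + (\<alpha> ^ (j - j) + \<alpha> ^ (j + j + 1))
      - 2 * (\<alpha> ^ (i - j) + \<alpha> ^ (i + j + 1))) / (4 * sqrt 2)"
    by (simp add: add_divide_distrib diff_divide_distrib)
  also have "\<alpha> ^ (i - i) + \<alpha> ^ (i + i + 1) + (\<alpha> ^ (j - j) + \<alpha> ^ (j + j + 1))
      - 2 * (\<alpha> ^ (i - j) + \<alpha> ^ (i + j + 1)) =
      (1 - \<alpha> ^ (i - j)) * (2 - \<alpha> ^ (i + j + 1) + \<alpha> ^ (2 * j + 1))"
    unfolding pows by (simp add: algebra_simps)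
  finally show ?thesis
    using filterlim_cong[OF refl refl eventually_mono[OF eventually_ge_at_top[of i]
        hex_resistance_PP[OF assms]]] by simp
qed

lemma hex_resistance_QP_limit:
  assumes "j \<le> i"
  shows "(\<lambda>n. hex_resistance n (Q i) (P j)) \<longlonglongrightarrow> real i - real j
    + (1 + \<alpha> ^ (i - j)) * (2 + \<alpha> ^ (i + j + 1) + \<alpha> ^ (2 * j + 1)) / (4 * sqrt 2)"
proof -
  define x y where "x = \<alpha> ^ (i - j)" and "y = \<alpha> ^ j"
  have "\<alpha> ^ i = x * y" using assms by (simp add: x_def y_def flip: power_add)
  then have pows: "\<alpha> ^ (i - i) = 1" "\<alpha> ^ (j - j) = 1" "\<alpha> ^ (i - j) = x"
    "\<alpha> ^ (i + i + 1) = \<alpha> * (x * y) * (x * y)" "\<alpha> ^ (j + j + 1) = \<alpha> * y * y"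
    "\<alpha> ^ (i + j + 1) = \<alpha> * (x * y) * y" "\<alpha> ^ (2 * j + 1) = \<alpha> * y * y"
    by (simp_all add: x_def y_def power_add mult_2)
  have "(\<lambda>n. real i - real j + (green n i i + green n j j + 2 * green n i j) / 2) \<longlonglongrightarrow>
      real i - real j + ((\<alpha> ^ (i - i) + \<alpha> ^ (i + i + 1)) / (2 * sqrt 2)
        + (\<alpha> ^ (j - j) + \<alpha> ^ (j + j + 1)) / (2 * sqrt 2)
        + 2 * ((\<alpha> ^ (i - j) + \<alpha> ^ (i + j + 1)) / (2 * sqrt 2))) / 2"
    (is "_ \<longlonglongrightarrow> ?l")
    by (intro tendsto_intros green_fixed_tendsto assms order_refl) auto
  also have "?l = real i - real j + (\<alpha> ^ (i - i) + \<alpha> ^ (i + i + 1) + (\<alpha> ^ (j - j) + \<alpha> ^ (j + j + 1))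
      + 2 * (\<alpha> ^ (i - j) + \<alpha> ^ (i + j + 1))) / (4 * sqrt 2)"
    by (simp add: add_divide_distrib diff_divide_distrib)
  also have "\<alpha> ^ (i - i) + \<alpha> ^ (i + i + 1) + (\<alpha> ^ (j - j) + \<alpha> ^ (j + j + 1))
      + 2 * (\<alpha> ^ (i - j) + \<alpha> ^ (i + j + 1)) =
      (1 + \<alpha> ^ (i - j)) * (2 + \<alpha> ^ (i + j + 1) + \<alpha> ^ (2 * j + 1))"
    unfolding pows by (simp add: algebra_simps)
  finally show ?thesis
    using filterlim_cong[OF refl refl eventually_mono[OF eventually_ge_at_top[of i]
        hex_resistance_QP[OF assms]]] by simp
qed

text \<open>A convergent deviation from \<open>n\<close> yields both the average and the increment
  limits, so the value of \<open>c\<close> is left open.\<close>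

lemma hex_resistance_ends_limit:
  "\<exists>c. (\<lambda>n. hex_resistance n (P n) (P 0) - real n) \<longlonglongrightarrow> c"
  "\<exists>c. (\<lambda>n. hex_resistance n (Q n) (P 0) - real n) \<longlonglongrightarrow> c"
proof -
  note lims = green_corner_tendsto green_fixed_tendsto[OF order_refl, of 0]
  have "(\<lambda>n. (green n n n + green n 0 0 - 2 * green n n 0) / 2) \<longlonglongrightarrow>
      ((1 + \<alpha>) / (2 * sqrt 2) + (\<alpha> ^ (0 - 0) + \<alpha> ^ (0 + 0 + 1)) / (2 * sqrt 2) - 2 * 0) / 2"
    by (intro tendsto_intros lims) auto
  then show "\<exists>c. (\<lambda>n. hex_resistance n (P n) (P 0) - real n) \<longlonglongrightarrow> c"
    by (auto simp: hex_resistance_PP)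
  have "(\<lambda>n. (green n n n + green n 0 0 + 2 * green n n 0) / 2) \<longlonglongrightarrow>
      ((1 + \<alpha>) / (2 * sqrt 2) + (\<alpha> ^ (0 - 0) + \<alpha> ^ (0 + 0 + 1)) / (2 * sqrt 2) + 2 * 0) / 2"
    by (intro tendsto_intros lims) auto
  then show "\<exists>c. (\<lambda>n. hex_resistance n (Q n) (P 0) - real n) \<longlonglongrightarrow> c"
    by (auto simp: hex_resistance_QP)
qed

lemma hex_resistance_middle_hexagon_limit:
  "(\<lambda>n. hex_resistance n (P ((n - 1) div 2 + 1)) (P ((n - 1) div 2))) \<longlonglongrightarrow> 2 - sqrt 2 / 2"
proof -
  let ?j = "\<lambda>n::nat. (n - 1) div 2" and ?i = "\<lambda>n::nat. (n - 1) div 2 + 1"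
  have j: "filterlim ?j at_top sequentially"
    unfolding filterlim_at_top eventually_sequentially
    by (intro allI, rule_tac x = "2 * Z + 1" in exI) auto
  then have i: "filterlim ?i at_top sequentially"
    by (rule filterlim_at_top_mono) simp
  have nj: "filterlim (\<lambda>n. n - ?j n) at_top sequentially"
    by (rule filterlim_at_top_mono[OF j]) (auto intro!: always_eventually)
  have ni: "filterlim (\<lambda>n. n - ?i n) at_top sequentially"
    unfolding filterlim_at_top eventually_sequentially
    by (intro allI, rule_tac x = "2 * Z + 2" in exI) auto
  \<comment> \<open>At \<open>n = 0\<close> truncated subtraction gives \<open>?i n = 1\<close>, so
    the bound holds only from 1 on.\<close>
  have ev: "\<forall>\<^sub>F n in sequentially. ?i n \<le> n"
    unfolding eventually_sequentially by (intro exI[of _ 1]) auto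
  have "(\<lambda>n. real (?i n) - real (?j n)
      + (green n (?i n) (?i n) + green n (?j n) (?j n) - 2 * green n (?i n) (?j n)) / 2) \<longlonglongrightarrow>
      1 + (\<alpha> ^ 0 / (2 * sqrt 2) + \<alpha> ^ 0 / (2 * sqrt 2) - 2 * (\<alpha> ^ 1 / (2 * sqrt 2))) / 2"
    by (intro tendsto_intros green_bulk_tendsto i j ni nj) (use ev in \<open>auto elim: eventually_mono\<close>)
  also have "1 + (\<alpha> ^ 0 / (2 * sqrt 2) + \<alpha> ^ 0 / (2 * sqrt 2) - 2 * (\<alpha> ^ 1 / (2 * sqrt 2))) / 2 =
      2 - sqrt 2 / 2"
    by (simp add: \<alpha> field_simps)
  finally show ?thesis
    using filterlim_cong[OF refl refl eventually_mono[OF ev hex_resistance_PP]] by simp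
qed

lemma hex_resistance_middle_rung_limit:
  "(\<lambda>n. hex_resistance n (P (n div 2)) (Q (n div 2))) \<longlonglongrightarrow> sqrt 2 / 2"
proof -
  let ?i = "\<lambda>n::nat. n div 2"
  have i: "filterlim ?i at_top sequentially"
    unfolding filterlim_at_top eventually_sequentially
    by (intro allI, rule_tac x = "2 * Z" in exI) auto
  have ni: "filterlim (\<lambda>n. n - ?i n) at_top sequentially"
    by (rule filterlim_at_top_mono[OF i]) (auto intro!: always_eventually)
  have eq: "hex_resistance n (P (?i n)) (Q (?i n)) = 2 * green n (?i n) (?i n)" for n
    unfolding hex_resistance_def
    by (subst resistance_distance_commute)
      (simp add: hex_resistance_QP flip: hex_resistance_def)
  have "(\<lambda>n. 2 * green n (?i n) (?i n)) \<longlonglongrightarrow> 2 * (\<alpha> ^ 0 / (2 * sqrt 2))"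
    by (intro tendsto_intros green_bulk_tendsto i ni) auto
  also have "2 * (\<alpha> ^ 0 / (2 * sqrt 2)) = sqrt 2 / 2"
    by (simp add: field_simps)
  finally show ?thesis by (simp add: eq)
qed

end

lemma asymptotically_linear_limits:
  fixes f :: "nat \<Rightarrow> real"
  assumes "\<exists>c. (\<lambda>n. f n - real n) \<longlonglongrightarrow> c"
  shows "(\<lambda>n. 1 / real n * f n) \<longlonglongrightarrow> 1" "(\<lambda>n. f (n + 1) - f n) \<longlonglongrightarrow> 1"
proof -
  obtain c where c: "(\<lambda>n. f n - real n) \<longlonglongrightarrow> c" using assms by blast
  have inv: "(\<lambda>n. 1 / real n) \<longlonglongrightarrow> 0" by real_asymp
  have "(\<lambda>n. 1 + 1 / real n * (f n - real n)) \<longlonglongrightarrow> 1 + 0 * c"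
    by (intro tendsto_intros c inv)
  \<comment> \<open>Only eventually: at \<open>n = 0\<close> division by zero makes the left side 1
    and the right side 0.\<close>
  moreover have "\<forall>\<^sub>F n in sequentially. 1 + 1 / real n * (f n - real n) = 1 / real n * f n"
    using eventually_gt_at_top[of 0] by eventually_elim (simp add: field_simps)
  ultimately show "(\<lambda>n. 1 / real n * f n) \<longlonglongrightarrow> 1"
    using tendsto_cong by fastforce
  have "(\<lambda>n. (f (Suc n) - real (Suc n)) - (f n - real n) + 1) \<longlonglongrightarrow> c - c + 1"
    by (intro tendsto_intros c LIMSEQ_Suc[OF c])
  then show "(\<lambda>n. f (n + 1) - f n) \<longlonglongrightarrow> 1" by simp
qed

theorem theorem3p6:
  fixes \<alpha> :: real
  assumes "\<alpha> = 3 - 2 * sqrt 2"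
  shows
    "(\<forall>i j :: nat. j \<le> i \<longrightarrow>
        (\<lambda>n. hex_resistance n (P i) (P j)) \<longlonglongrightarrow>
          real i - real j
            + (1 - \<alpha> ^ (i - j)) * (2 - \<alpha> ^ (i + j + 1) + \<alpha> ^ (2 * j + 1)) / (4 * sqrt 2) \<and>
        (\<lambda>n. hex_resistance n (Q i) (P j)) \<longlonglongrightarrow>
          real i - real j
            + (1 + \<alpha> ^ (i - j)) * (2 + \<alpha> ^ (i + j + 1) + \<alpha> ^ (2 * j + 1)) / (4 * sqrt 2)) \<and>
     (\<lambda>n. 1 / real n * hex_resistance n (P n) (P 0)) \<longlonglongrightarrow> 1 \<and>
     (\<lambda>n. 1 / real n * hex_resistance n (Q n) (P 0)) \<longlonglongrightarrow> 1 \<and>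
     (\<lambda>n. hex_resistance (n + 1) (P (n + 1)) (P 0) - hex_resistance n (P n) (P 0)) \<longlonglongrightarrow> 1 \<and>
     (\<lambda>n. hex_resistance (n + 1) (Q (n + 1)) (P 0) - hex_resistance n (Q n) (P 0)) \<longlonglongrightarrow> 1 \<and>
     (\<lambda>n. hex_resistance n (P ((n - 1) div 2 + 1)) (P ((n - 1) div 2))) \<longlonglongrightarrow> 2 - sqrt 2 / 2 \<and>
     (\<lambda>n. hex_resistance n (P (n div 2)) (Q (n div 2))) \<longlonglongrightarrow> sqrt 2 / 2"
  using hex_resistance_PP_limit[OF assms] hex_resistance_QP_limit[OF assms]
    asymptotically_linear_limits[OF hex_resistance_ends_limit(1)[OF assms]]
    asymptotically_linear_limits[OF hex_resistance_ends_limit(2)[OF assms]]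
    hex_resistance_middle_hexagon_limit[OF assms] hex_resistance_middle_rung_limit[OF assms]
  by blast

end
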